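(* For every $d\ge 1$ there exist constants $\varepsilon_d,\sigma_d>0$ such that $$\int_{B^d_{r(g)}} g_+ \ \ge\ \sigma_d\,\|g\|_{L^1(\mathbb{R}^d)}$$ whenever $g\in\mathcal A_-(d)$ is a radial function with $\widehat g=-g$, $g(0)=0$, and $|r(g)-\mathbb{A}_-(d)|\le \varepsilon_d$.
   Context: Fourier transform: $\widehat f(\xi)=\int_{\mathbb{R}^d} f(x)e^{-2\pi i\langle x,\xi\rangle}\,dx$. A function $f:\mathbb{R}^d\to\mathbb{R}$ is eventually nonnegative if $f(x)\ge0$ for all sufficiently large $|x|$. $r(f):=\inf\{r>0: f(x)\ge 0 \text{ for all } |x|\ge r\}$. $\mathcal A_-(d)$ is the set of $f\in L^1(\mathbb{R}^d)$, $f:\mathbb{R}^d\to\mathbb{R}$, with $\widehat f\in L^1(\mathbb{R}^d)$ real-valued, such that $\widehat f(0)\le0$ and $f$ is eventually nonnegative, and $f(0)\ge 0$ and $-\widehat f$ is eventually nonnegative. $\mathbb{A}_-(d):=\inf\{\sqrt{r(f)\,r(-\widehat f)}: f\in\mathcal A_-(d)\setminus\{0\}\}$. $B^d_r$ is the open ball of radius $r$ centered at the origin in $\mathbb{R}^d$, and $g_+:=\max\{g,0\}$. *)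

theory Defs
  imports "HOL-Analysis.Analysis"
begin

text \<open>Fourier transform with the convention
  hat f(xi) = integral of f(x) e^{-2 pi i <x,xi>} dx, for real-valued f on R^d
  (R^d rendered as an arbitrary euclidean_space 'a with d = DIM('a)).\<close>
definition fourier :: "('a::euclidean_space \<Rightarrow> real) \<Rightarrow> 'a \<Rightarrow> complex" where
  "fourier f \<xi> = (LINT x|lebesgue. complex_of_real (f x) * cis (- 2 * pi * (x \<bullet> \<xi>)))"

definition fourier_re :: "('a::euclidean_space \<Rightarrow> real) \<Rightarrow> 'a \<Rightarrow> real" where
  "fourier_re f \<xi> = Re (fourier f \<xi>)"

definition eventually_nonneg :: "('a::euclidean_space \<Rightarrow> real) \<Rightarrow> bool" where
  "eventually_nonneg f \<longleftrightarrow> (\<exists>R. \<forall>x. norm x \<ge> R \<longrightarrow> f x \<ge> 0)"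

definition rf :: "('a::euclidean_space \<Rightarrow> real) \<Rightarrow> real" where
  "rf f = Inf {r. r > 0 \<and> (\<forall>x. norm x \<ge> r \<longrightarrow> f x \<ge> 0)}"

text \<open>The class A_-(d).  Functions are taken to be the continuous representative.\<close>
definition A_minus_class :: "('a::euclidean_space \<Rightarrow> real) set" where
  "A_minus_class = {f. continuous_on UNIV f
      \<and> integrable lebesgue f
      \<and> (\<forall>\<xi>. Im (fourier f \<xi>) = 0)
      \<and> integrable lebesgue (fourier_re f)
      \<and> fourier_re f 0 \<le> 0
      \<and> eventually_nonneg f
      \<and> f 0 \<ge> 0
      \<and> eventually_nonneg (\<lambda>\<xi>. - fourier_re f \<xi>)}"

definition A_minus_const :: "'a::euclidean_space itself \<Rightarrow> real" where
  "A_minus_const (TYPE('a)) = Inf {sqrt (rf f * rf (\<lambda>\<xi>. - fourier_re f \<xi>)) | f :: 'a \<Rightarrow> real.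
      f \<in> A_minus_class \<and> f \<noteq> (\<lambda>_. 0)}"

definition radial :: "('a::euclidean_space \<Rightarrow> real) \<Rightarrow> bool" where
  "radial f \<longleftrightarrow> (\<forall>x y. norm x = norm y \<longrightarrow> f x = f y)"

end

theory Submission
  imports Defs "HOL-Probability.Characteristic_Functions"
begin

text \<open>
  Let \<open>r = r(g)\<close>. The hypotheses give \<open>\<integral> g = -g(0) = 0\<close>, and, because the
  Gaussian is its own Fourier transform, also \<open>\<integral> g(x) exp(-\<pi>|x|\<^sup>2) dx = 0\<close>.
  Hence \<open>g\<close> is orthogonal to \<open>w(x) = exp(-\<pi>|x|\<^sup>2) - exp(-\<pi>r\<^sup>2)\<close>, which is positive
  inside the ball of radius \<open>r\<close> and negative outside. Since \<open>g \<ge> 0\<close> outside the ball,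
  this yields \<open>\<integral> |g||w| = 2 \<integral>\<^bsub>|x|<r\<^esub> g\<^sub>+ w \<le> 2 \<integral>\<^bsub>|x|<r\<^esub> g\<^sub>+\<close>.
  Finally \<open>|w|\<close> is bounded below off a thin shell around \<open>|x| = r\<close>, uniformly for bounded
  \<open>r\<close>, and the shell carries at most half of the mass of \<open>g\<close> because
  \<open>-g\<close> is the Fourier transform of \<open>g\<close>, whence \<open>sup |g| \<le> \<parallel>g\<parallel>\<^sub>1\<close>.
\<close>

section \<open>The Gaussian is its own Fourier transform\<close>

lemma gaussian_real_integral:
  fixes t :: real
  defines "f \<equiv> \<lambda>x. complex_of_real (exp (- pi * x\<^sup>2)) * cis (- 2 * pi * (x * t))"
  shows "integrable lborel f" and "integral\<^sup>L lborel f = complex_of_real (exp (- pi * t\<^sup>2))"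
proof -
  \<comment> \<open>Rescaling by \<open>c\<close> turns \<open>exp (- pi * x\<^sup>2)\<close> into
    the standard normal density, so the integral is the characteristic function of the normal law at
    \<open>- (c * t)\<close>, namely \<open>exp (- (c * t)\<^sup>2 / 2)\<close>.\<close>
  define c where "c = sqrt (2 * pi)"
  have c: "c > 0" "c\<^sup>2 = 2 * pi" by (simp_all add: c_def)
  define h where "h = (\<lambda>x. std_normal_density x *\<^sub>R iexp (- (c * t) * x))"
  have h_scaled: "c *\<^sub>R h (0 + c * x) = f x" for x
  proof -
    have "- (c * x)\<^sup>2 / 2 = - pi * x\<^sup>2" "- (c * t) * (c * x) = - 2 * pi * (x * t)"
      using c(2) by (simp_all add: power2_eq_square algebra_simps)
    moreover have "c * (1 / sqrt (2 * pi)) = 1" using c(1) by (simp add: c_def)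
    ultimately show ?thesis
      by (simp only: h_def f_def std_normal_density_def cis_conv_exp add_0)
         (simp add: scaleR_conv_of_real c_def)
  qed
  have h_int: "integrable lborel h"
  proof (rule Bochner_Integration.integrable_bound)
    show "integrable lborel std_normal_density"
      using integrable_std_normal_moment[of 0] by simp
    show "h \<in> borel_measurable lborel" unfolding h_def by measurable
    show "AE x in lborel. norm (h x) \<le> norm (std_normal_density x)"
      by (simp add: h_def del: of_real_mult)
  qed
  have "integrable lborel (\<lambda>x. h (0 + c * x))"
    using h_int c(1) by (intro lborel_integrable_real_affine) auto
  then have "integrable lborel (\<lambda>x. c *\<^sub>R h (0 + c * x))" by simp
  then show "integrable lborel f" by (simp only: h_scaled)
  have "integral\<^sup>L lborel f = c *\<^sub>R (\<integral>x. h (0 + c * x) \<partial>lborel)"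
    by (simp only: h_scaled flip: integral_scaleR_right)
  also have "\<dots> = integral\<^sup>L lborel h"
    using lborel_integral_real_affine[of c h 0] c(1) by simp
  also have "\<dots> = char std_normal_distribution (- (c * t))"
    unfolding char_def h_def by (subst integral_density) auto
  also have "\<dots> = complex_of_real (exp (- pi * t\<^sup>2))"
    using c(2) by (simp add: char_std_normal_distribution power_mult_distrib)
  finally show "integral\<^sup>L lborel f = complex_of_real (exp (- pi * t\<^sup>2))" .
qed

text \<open>\<open>lborel\<close> is the image of the product measure over \<open>Basis\<close>, so
  Fubini splits the integral. The factor may depend on \<open>b\<close> because the frequency
  \<open>\<xi> \<bullet> b\<close> differs between coordinates.\<close>

lemma lborel_integral_prod:
  fixes f :: "'a::euclidean_space \<Rightarrow> real \<Rightarrow> 'b::{real_normed_field,banach,second_countable_topology}"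
  assumes f: "\<And>b. b \<in> Basis \<Longrightarrow> integrable lborel (f b)"
  shows "integrable lborel (\<lambda>x. \<Prod>b\<in>Basis. f b (x \<bullet> b))"
    and "(\<integral>x. (\<Prod>b\<in>Basis. f b (x \<bullet> b)) \<partial>lborel) = (\<Prod>b\<in>Basis. integral\<^sup>L lborel (f b))"
proof -
  interpret product_sigma_finite "\<lambda>_::'a. lborel :: real measure"
    by standard
  have [measurable]: "f b \<in> borel_measurable borel" if "b \<in> Basis" for b
    using f[OF that] by (auto dest: borel_measurable_integrable)
  have m: "(\<lambda>x. \<Prod>b\<in>Basis. f b (x \<bullet> b)) \<in> borel_measurable borel"
    by measurable
  have T: "(\<lambda>x. \<Sum>b\<in>Basis. x b *\<^sub>R b) \<in> (\<Pi>\<^sub>M b\<in>Basis. lborel) \<rightarrow>\<^sub>M (borel :: 'a measure)"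
    by measurable
  have coord: "(\<Prod>b\<in>Basis. f b ((\<Sum>i\<in>Basis. x i *\<^sub>R i) \<bullet> b)) = (\<Prod>b\<in>Basis. f b (x b))" for x
    by (intro prod.cong refl) simp
  show "integrable lborel (\<lambda>x. \<Prod>b\<in>Basis. f b (x \<bullet> b))"
    by (subst lborel_eq, subst integrable_distr_eq[OF T m])
       (simp only: coord, intro product_integrable_prod f finite_Basis)
  show "(\<integral>x. (\<Prod>b\<in>Basis. f b (x \<bullet> b)) \<partial>lborel) = (\<Prod>b\<in>Basis. integral\<^sup>L lborel (f b))"
    by (subst lborel_eq, subst integral_distr[OF T m])
       (simp only: coord, intro product_integral_prod f finite_Basis)
qed

lemma gaussian_integral:
  fixes \<xi> :: "'a::euclidean_space"
  defines "f \<equiv> \<lambda>x. complex_of_real (exp (- pi * (norm x)\<^sup>2)) * cis (- 2 * pi * (x \<bullet> \<xi>))"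
  shows "integrable lborel f" and "integral\<^sup>L lborel f = complex_of_real (exp (- pi * (norm \<xi>)\<^sup>2))"
proof -
  have norm_sq: "(norm x)\<^sup>2 = (\<Sum>b\<in>Basis. (x \<bullet> b)\<^sup>2)" for x :: 'a
    by (subst power2_norm_eq_inner, subst euclidean_inner) (simp add: power2_eq_square)
  have exp_prod: "exp (- pi * (norm x)\<^sup>2) = (\<Prod>b\<in>Basis. exp (- pi * (x \<bullet> b)\<^sup>2))" for x :: 'a
    by (simp add: norm_sq sum_distrib_left exp_sum flip: sum_negf)
  have cis_prod: "cis (- 2 * pi * (x \<bullet> \<xi>)) = (\<Prod>b\<in>Basis. cis (- 2 * pi * ((x \<bullet> b) * (\<xi> \<bullet> b))))" for x
    by (subst euclidean_inner)
       (simp add: cis_conv_exp sum_distrib_left sum_distrib_right exp_sum flip: sum_negf)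
  have f_prod: "f x = (\<Prod>b\<in>Basis. complex_of_real (exp (- pi * (x \<bullet> b)\<^sup>2)) * cis (- 2 * pi * ((x \<bullet> b) * (\<xi> \<bullet> b))))" for x
    unfolding f_def exp_prod cis_prod by (simp only: of_real_prod prod.distrib)
  show "integrable lborel f"
    unfolding f_prod[abs_def]
    by (rule lborel_integral_prod(1)[of "\<lambda>b x. complex_of_real (exp (- pi * x\<^sup>2)) * cis (- 2 * pi * (x * (\<xi> \<bullet> b)))"])
       (rule gaussian_real_integral)
  show "integral\<^sup>L lborel f = complex_of_real (exp (- pi * (norm \<xi>)\<^sup>2))"
    unfolding f_prod[abs_def]
    by (subst lborel_integral_prod(2)[of "\<lambda>b x. complex_of_real (exp (- pi * x\<^sup>2)) * cis (- 2 * pi * (x * (\<xi> \<bullet> b)))"])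
       (simp_all only: gaussian_real_integral exp_prod of_real_prod)
qed

lemma integrable_gaussian: "integrable lborel (\<lambda>x::'a::euclidean_space. exp (- pi * (norm x)\<^sup>2))"
  using integrable_norm[OF gaussian_integral(1)[of "0::'a"]] by (simp add: norm_mult)

section \<open>Vanishing Gaussian moment\<close>

lemma fourier_gaussian_adjoint:
  fixes g :: "'a::euclidean_space \<Rightarrow> real"
  assumes g: "integrable lborel g"
  shows "(\<integral>\<xi>. fourier g \<xi> * complex_of_real (exp (- pi * (norm \<xi>)\<^sup>2)) \<partial>lborel)
       = complex_of_real (\<integral>x. g x * exp (- pi * (norm x)\<^sup>2) \<partial>lborel)"
proof -
  note [measurable] = borel_measurable_integrable[OF g]
  \<comment> \<open>The kernel for moving the transform from \<open>g\<close> onto the Gaussian. Its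
    norm is a product of an integrable function of \<open>x\<close> and one of \<open>\<xi>\<close>,
    which justifies Fubini.\<close>
  define K where "K = (\<lambda>x \<xi>::'a. complex_of_real (g x) * cis (- 2 * pi * (x \<bullet> \<xi>))
                          * complex_of_real (exp (- pi * (norm \<xi>)\<^sup>2)))"
  have cis_meas: "cis \<in> borel_measurable borel"
    by (intro borel_measurable_continuous_onI continuous_intros)
  note [measurable] = cis_meas
  have K_norm: "norm (K x \<xi>) = \<bar>g x\<bar> * exp (- pi * (norm \<xi>)\<^sup>2)" for x \<xi>
    by (simp add: K_def norm_mult)
  have K_meas: "case_prod K \<in> borel_measurable (lborel \<Otimes>\<^sub>M lborel)"
    unfolding K_def by measurable
  have K_sect: "integrable lborel (K x)" for x
  proof (rule Bochner_Integration.integrable_bound)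
    show "integrable lborel (\<lambda>\<xi>::'a. \<bar>g x\<bar> * exp (- pi * (norm \<xi>)\<^sup>2))"
      by (intro integrable_mult_right integrable_gaussian)
    show "K x \<in> borel_measurable lborel" unfolding K_def by measurable
  qed (simp add: K_norm)
  have K_int: "integrable (lborel \<Otimes>\<^sub>M lborel) (case_prod K)"
    by (rule lborel_pair.Fubini_integrable[OF K_meas]) (use K_sect g in \<open>simp_all add: K_norm\<close>)
  have inner: "(\<integral>\<xi>. K x \<xi> \<partial>lborel) = complex_of_real (g x * exp (- pi * (norm x)\<^sup>2))" for x
  proof -
    have "(\<integral>\<xi>. K x \<xi> \<partial>lborel) = (\<integral>\<xi>. complex_of_real (g x) *
        (complex_of_real (exp (- pi * (norm \<xi>)\<^sup>2)) * cis (- 2 * pi * (\<xi> \<bullet> x))) \<partial>lborel)"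
      by (simp add: K_def mult_ac inner_commute)
    also have "\<dots> = complex_of_real (g x) * complex_of_real (exp (- pi * (norm x)\<^sup>2))"
      by (simp only: integral_mult_right_zero gaussian_integral(2))
    finally show ?thesis by simp
  qed
  have "fourier g \<xi> * complex_of_real (exp (- pi * (norm \<xi>)\<^sup>2)) = (\<integral>x. K x \<xi> \<partial>lborel)" for \<xi>
    unfolding fourier_def K_def by (subst integral_completion) simp_all
  then have "(\<integral>\<xi>. fourier g \<xi> * complex_of_real (exp (- pi * (norm \<xi>)\<^sup>2)) \<partial>lborel)
      = (\<integral>\<xi>. (\<integral>x. K x \<xi> \<partial>lborel) \<partial>lborel)" by simp
  also have "\<dots> = (\<integral>x. (\<integral>\<xi>. K x \<xi> \<partial>lborel) \<partial>lborel)"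
    by (rule lborel_pair.Fubini_integral[OF K_int])
  also have "\<dots> = (\<integral>x. complex_of_real (g x * exp (- pi * (norm x)\<^sup>2)) \<partial>lborel)"
    by (simp only: inner)
  also have "\<dots> = complex_of_real (\<integral>x. g x * exp (- pi * (norm x)\<^sup>2) \<partial>lborel)"
    by (rule integral_complex_of_real)
  finally show ?thesis .
qed

text \<open>Moving the transform onto the self-dual Gaussian leaves the moment unchanged, while
  replacing \<open>fourier g\<close> by \<open>- g\<close> flips its sign; hence it equals its own
  negative.\<close>

lemma gaussian_moment_eq_0:
  fixes g :: "'a::euclidean_space \<Rightarrow> real"
  assumes g: "integrable lborel g"
    and anti: "\<And>\<xi>. fourier g \<xi> = complex_of_real (- g \<xi>)"
  shows "(\<integral>x. g x * exp (- pi * (norm x)\<^sup>2) \<partial>lborel) = 0"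
proof -
  let ?I = "\<integral>x. g x * exp (- pi * (norm x)\<^sup>2) \<partial>lborel"
  have "complex_of_real ?I = (\<integral>\<xi>. complex_of_real (- (g \<xi> * exp (- pi * (norm \<xi>)\<^sup>2))) \<partial>lborel)"
    using fourier_gaussian_adjoint[OF g] by (simp add: anti)
  also have "\<dots> = complex_of_real (- ?I)"
    by (simp only: integral_complex_of_real integral_minus)
  finally show ?thesis by (simp only: of_real_eq_iff)
qed

section \<open>Sup bound and sign outside the radius\<close>

lemma norm_fourier_le: "norm (fourier g \<xi>) \<le> (\<integral>x. \<bar>g x\<bar> \<partial>lebesgue)"
proof -
  have "norm (fourier g \<xi>) \<le> (\<integral>x. norm (complex_of_real (g x) * cis (- 2 * pi * (x \<bullet> \<xi>))) \<partial>lebesgue)"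
    unfolding fourier_def by (rule integral_norm_bound)
  then show ?thesis by (simp add: norm_mult)
qed

lemma fourier_0: "fourier g 0 = complex_of_real (\<integral>x. g x \<partial>lebesgue)"
  by (simp add: fourier_def)

text \<open>The inequality \<open>norm x > rf f\<close> is strict because the infimum need not be
  attained for a general \<open>f\<close>.\<close>

lemma rf_nonneg_and_sign:
  assumes "eventually_nonneg f"
  shows "rf f \<ge> 0" and "norm x > rf f \<Longrightarrow> f x \<ge> 0"
proof -
  let ?S = "{r. r > 0 \<and> (\<forall>x. norm x \<ge> r \<longrightarrow> f x \<ge> 0)}"
  obtain R where "\<And>x. norm x \<ge> R \<Longrightarrow> f x \<ge> 0"
    using assms by (auto simp: eventually_nonneg_def)
  \<comment> \<open>\<open>R\<close> may be nonpositive, whereas members of the set must be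
    positive.\<close>
  then have "max R 1 \<in> ?S" by auto
  then have ne: "?S \<noteq> {}" by blast
  show "rf f \<ge> 0" unfolding rf_def by (rule cInf_greatest[OF ne]) auto
  show "f x \<ge> 0" if "norm x > rf f"
    using cInf_lessD[OF ne] that unfolding rf_def by fastforce
qed

section \<open>Constants uniform in the radius\<close>

lemma thin_shell_measure:
  fixes R e :: real
  assumes "e > 0"
  obtains \<delta> where "\<delta> > 0"
    "\<And>r. 0 \<le> r \<Longrightarrow> r \<le> R \<Longrightarrow> measure lebesgue (cball (0::'a::euclidean_space) (r + \<delta>) - ball 0 (r - \<delta>)) < e"
proof -
  \<comment> \<open>Truncating at 0 keeps the volume formula valid for negative radii, where the
    ball is empty; \<open>r - \<delta>\<close> can be negative.\<close>
  define vol where "vol = (\<lambda>\<rho>. unit_ball_vol (DIM('a)) * max \<rho> 0 ^ DIM('a))"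
  have vol: "measure lebesgue (cball (0::'a) \<rho>) = vol \<rho>" "measure lebesgue (ball (0::'a) \<rho>) = vol \<rho>" for \<rho>
  proof -
    have "measure lebesgue (cball (0::'a) \<rho>) = vol \<rho> \<and> measure lebesgue (ball (0::'a) \<rho>) = vol \<rho>"
    proof (cases "\<rho> \<ge> 0")
      case True
      then show ?thesis
        by (simp add: vol_def measure_completion content_cball content_ball)
    next
      case False
      then have "cball (0::'a) \<rho> = {}" "ball (0::'a) \<rho> = {}" "vol \<rho> = 0"
        by (auto simp: vol_def max_def)
      then show ?thesis by simp
    qed
    then show "measure lebesgue (cball (0::'a) \<rho>) = vol \<rho>" "measure lebesgue (ball (0::'a) \<rho>) = vol \<rho>"
      by blast+
  qed
  \<comment> \<open>The interval contains \<open>r - \<delta>\<close> and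
    \<open>r + \<delta>\<close> for every \<open>r\<close> in \<open>{0..R}\<close> once
    \<open>\<delta> \<le> 1\<close>. Uniform continuity then yields one \<open>\<delta>\<close> for
    all these radii.\<close>
  have "uniformly_continuous_on {-1..R+1} vol"
    unfolding vol_def by (intro compact_uniformly_continuous continuous_intros) auto
  then obtain d where d: "d > 0"
    "\<And>a b. a \<in> {-1..R+1} \<Longrightarrow> b \<in> {-1..R+1} \<Longrightarrow> dist b a < d \<Longrightarrow> dist (vol b) (vol a) < e"
    using assms unfolding uniformly_continuous_on_def by meson
  define \<delta> where "\<delta> = min 1 (d / 3)"
  have \<delta>: "\<delta> > 0" "\<delta> \<le> 1" "2 * \<delta> < d" using d(1) by (auto simp: \<delta>_def)
  show thesis
  proof
    show "\<delta> > 0" by fact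
    fix r :: real assume r: "0 \<le> r" "r \<le> R"
    have "measure lebesgue (cball (0::'a) (r + \<delta>) - ball 0 (r - \<delta>)) = vol (r + \<delta>) - vol (r - \<delta>)"
      using \<delta>(1) by (subst measurable_measure_Diff) (auto simp: vol)
    also have "\<dots> < e"
      using d(2)[of "r - \<delta>" "r + \<delta>"] r \<delta> by (auto simp: dist_real_def)
    finally show "measure lebesgue (cball (0::'a) (r + \<delta>) - ball 0 (r - \<delta>)) < e" .
  qed
qed

text \<open>The Gaussian profile decreases, so the gap is at least \<open>h r\<close> when
  \<open>s\<close> lies above \<open>r\<close>, and at least \<open>h s\<close> when it lies below.
  Both arguments are in \<open>{0..R}\<close>, where the positive continuous \<open>h\<close>
  attains its minimum \<open>c\<close>.\<close>

lemma gaussian_gap: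
  fixes R \<delta> :: real
  assumes "\<delta> > 0" "R \<ge> 0"
  obtains c where "c > 0"
    "\<And>r s. 0 \<le> r \<Longrightarrow> r \<le> R \<Longrightarrow> 0 \<le> s \<Longrightarrow> \<bar>s - r\<bar> \<ge> \<delta> \<Longrightarrow> \<bar>exp (- pi * s\<^sup>2) - exp (- pi * r\<^sup>2)\<bar> \<ge> c"
proof -
  define h where "h = (\<lambda>r::real. exp (- pi * r\<^sup>2) - exp (- pi * (r + \<delta>)\<^sup>2))"
  have anti: "exp (- pi * b\<^sup>2) \<le> exp (- pi * a\<^sup>2)" if "0 \<le> a" "a \<le> b" for a b :: real
    using that by (simp add: power_mono)
  have "continuous_on {0..R} h" unfolding h_def by (intro continuous_intros)
  then obtain m where m: "m \<in> {0..R}" "\<And>r. r \<in> {0..R} \<Longrightarrow> h m \<le> h r"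
    using continuous_attains_inf[of "{0..R}" h] assms(2) by auto
  show thesis
  proof
    show "h m > 0" using m(1) assms(1) by (auto simp: h_def intro!: power_strict_mono)
    fix r s :: real assume rs: "0 \<le> r" "r \<le> R" "0 \<le> s" "\<bar>s - r\<bar> \<ge> \<delta>"
    show "\<bar>exp (- pi * s\<^sup>2) - exp (- pi * r\<^sup>2)\<bar> \<ge> h m"
    proof (cases "s \<ge> r")
      case True
      then have "exp (- pi * s\<^sup>2) \<le> exp (- pi * (r + \<delta>)\<^sup>2)" using rs assms by (intro anti) auto
      moreover have "h m \<le> h r" using m(2) rs by simp
      ultimately show ?thesis unfolding h_def by linarith
    next
      case False
      then have "exp (- pi * r\<^sup>2) \<le> exp (- pi * (s + \<delta>)\<^sup>2)" using rs assms by (intro anti) auto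
      moreover have "h m \<le> h s" using m(2) rs False by simp
      ultimately show ?thesis unfolding h_def by linarith
    qed
  qed
qed

section \<open>The mass inequality at a fixed radius\<close>

lemma ball_positive_mass_ge:
  fixes g :: "'a::euclidean_space \<Rightarrow> real" and r c \<delta> :: real
  defines "N \<equiv> \<integral>x. \<bar>g x\<bar> \<partial>lebesgue"
  assumes g: "integrable lebesgue g" "g \<in> borel_measurable borel"
    and anti: "\<And>\<xi>. fourier g \<xi> = complex_of_real (- g \<xi>)" and g0: "g 0 = 0"
    and r: "r \<ge> 0" "\<And>x. norm x > r \<Longrightarrow> g x \<ge> 0"
    and shell: "measure lebesgue (cball (0::'a) (r + \<delta>) - ball 0 (r - \<delta>)) \<le> 1/2"
    and c: "c > 0"
      "\<And>s. 0 \<le> s \<Longrightarrow> \<bar>s - r\<bar> \<ge> \<delta> \<Longrightarrow> \<bar>exp (- pi * s\<^sup>2) - exp (- pi * r\<^sup>2)\<bar> \<ge> c"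
  shows "(\<integral>x\<in>ball 0 r. max (g x) 0 \<partial>lebesgue) \<ge> c / 4 * N"
proof -
  define w where "w = (\<lambda>x::'a. exp (- pi * (norm x)\<^sup>2) - exp (- pi * r\<^sup>2))"
  define P where "P = (\<lambda>x. indicator (ball 0 r) x * max (g x) 0)"
  define A where "A = cball (0::'a) (r + \<delta>) - ball 0 (r - \<delta>)"
  have exp_le: "exp (- pi * b\<^sup>2) \<le> exp (- pi * a\<^sup>2)" if "0 \<le> a" "a \<le> b" for a b :: real
    using that by (simp add: power_mono)
  have w_le: "\<bar>w x\<bar> \<le> 1" for x
  proof -
    have "0 < exp (- pi * (norm x)\<^sup>2)" "exp (- pi * (norm x)\<^sup>2) \<le> 1"
      "0 < exp (- pi * r\<^sup>2)" "exp (- pi * r\<^sup>2) \<le> 1" by simp_all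
    then show ?thesis unfolding w_def by linarith
  qed
  have w_meas [measurable]: "w \<in> borel_measurable borel" unfolding w_def by measurable
  note [measurable] = g(2)
  have g_lb: "integrable lborel g"
    using g by (simp add: integrable_completion)
  \<comment> \<open>Covers both \<open>w * g\<close> and \<open>P\<close>, the latter being
    \<open>g\<close> times the indicator of the part of the ball where
    \<open>g \<ge> 0\<close>.\<close>
  have bounded_mult: "integrable lebesgue (\<lambda>x. f x * g x)"
    if "f \<in> borel_measurable borel" "\<And>x. \<bar>f x\<bar> \<le> 1" for f :: "'a \<Rightarrow> real"
  proof (rule Bochner_Integration.integrable_bound[OF g(1)])
    note [measurable] = that(1)
    have "(\<lambda>x. f x * g x) \<in> borel_measurable borel" by measurable
    then show "(\<lambda>x. f x * g x) \<in> borel_measurable lebesgue"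
      by (intro measurable_completion) simp
    show "AE x in lebesgue. norm (f x * g x) \<le> norm (g x)"
      using that(2) by (simp add: abs_mult mult_left_le_one_le)
  qed
  have gw_int: "integrable lebesgue (\<lambda>x. w x * g x)"
    by (rule bounded_mult) (auto simp: w_le)
  have P_int: "integrable lebesgue P"
  proof -
    have "integrable lebesgue (\<lambda>x. (indicator (ball 0 r) x * indicator {x. g x \<ge> 0} x) * g x)"
      by (rule bounded_mult) (auto simp: indicator_def)
    also have "(\<lambda>x. (indicator (ball 0 r) x * indicator {x. g x \<ge> 0} x) * g x) = P"
      by (auto simp: P_def indicator_def max_def)
    finally show ?thesis .
  qed
  have gw_0: "(\<integral>x. w x * g x \<partial>lebesgue) = 0"
  proof -
    have "(\<integral>x. g x \<partial>lebesgue) = 0"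
      using anti[of 0] g0 by (simp add: fourier_0)
    then have int0: "(\<integral>x. g x \<partial>lborel) = 0"
      using g(2) by (simp add: integral_completion)
    have ge_int: "integrable lborel (\<lambda>x. g x * exp (- pi * (norm x)\<^sup>2))"
      by (rule Bochner_Integration.integrable_bound[OF g_lb])
         (auto simp: abs_mult mult_left_le)
    have "(\<integral>x. w x * g x \<partial>lebesgue) = (\<integral>x. w x * g x \<partial>lborel)"
      by (rule integral_completion) simp
    also have "\<dots> = (\<integral>x. g x * exp (- pi * (norm x)\<^sup>2) - exp (- pi * r\<^sup>2) * g x \<partial>lborel)"
      by (simp add: w_def algebra_simps)
    also have "\<dots> = 0"
      using ge_int g_lb gaussian_moment_eq_0[OF g_lb anti] int0
      by (subst Bochner_Integration.integral_diff) auto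
    finally show ?thesis .
  qed
  have g_le: "\<bar>g x\<bar> \<le> N" for x
    using norm_fourier_le[of g x] by (simp add: anti N_def)
  have A_fin: "A \<in> lmeasurable" unfolding A_def by (intro fmeasurable.Diff) auto
  have N_nonneg: "N \<ge> 0" unfolding N_def by simp
  \<comment> \<open>Integrating this gives the result: the \<open>w * g\<close> term vanishes, and
    the last term pays for the shell \<open>A\<close>, where \<open>\<bar>w\<bar>\<close> has no
    lower bound but \<open>\<bar>g\<bar> \<le> N\<close>.\<close>
  have pointwise: "c * \<bar>g x\<bar> \<le> 2 * P x - w x * g x + c * N * indicator A x" for x
  proof -
    \<comment> \<open>Inside the ball \<open>\<bar>w\<bar> * \<bar>g\<bar> + w * g\<close> is
      \<open>2 * w * max g 0\<close> with \<open>0 \<le> w \<le> 1\<close>; outside it is 0.\<close>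
    have "\<bar>w x\<bar> * \<bar>g x\<bar> \<le> 2 * P x - w x * g x"
    proof (cases "norm x < r")
      case True
      then have "w x \<ge> 0" unfolding w_def using exp_le[of "norm x" r] by simp
      moreover have "w x * max (g x) 0 \<le> max (g x) 0"
        using w_le[of x] by (intro mult_left_le_one_le) (use \<open>w x \<ge> 0\<close> in auto)
      ultimately show ?thesis using True
        by (auto simp: P_def max_def abs_if split: if_splits)
    next
      case False
      then have "w x \<le> 0" unfolding w_def using exp_le[of r "norm x"] r(1) by simp
      \<comment> \<open>On the sphere \<open>norm x = r\<close> the sign of \<open>g\<close> is not
        given, but \<open>w\<close> vanishes there.\<close>
      moreover have "w x = 0 \<or> g x \<ge> 0"
        using False r(2)[of x] by (cases "norm x = r") (auto simp: w_def)
      ultimately show ?thesis using False by (auto simp: P_def)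
    qed
    moreover have "c * \<bar>g x\<bar> \<le> \<bar>w x\<bar> * \<bar>g x\<bar> + c * N * indicator A x"
    proof (cases "x \<in> A")
      case True
      have "c * \<bar>g x\<bar> \<le> c * N" using g_le c(1) by simp
      moreover have "0 \<le> \<bar>w x\<bar> * \<bar>g x\<bar>" by (rule mult_nonneg_nonneg) simp_all
      ultimately have "c * \<bar>g x\<bar> \<le> \<bar>w x\<bar> * \<bar>g x\<bar> + c * N" by linarith
      then show ?thesis using True by simp
    next
      case False
      then have "\<bar>norm x - r\<bar> \<ge> \<delta>" by (auto simp: A_def)
      then have "c \<le> \<bar>w x\<bar>" unfolding w_def by (intro c(2)) auto
      then show ?thesis using False by (simp add: mult_right_mono)
    qed
    ultimately show ?thesis by linarith
  qed
  have A_int: "integrable lebesgue (indicator A :: 'a \<Rightarrow> real)"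
    using A_fin by (intro integrable_real_indicator) (auto simp: fmeasurable_def)
  have "(\<integral>x. c * \<bar>g x\<bar> \<partial>lebesgue) \<le> (\<integral>x. 2 * P x - w x * g x + c * N * indicator A x \<partial>lebesgue)"
    by (intro integral_mono pointwise integrable_mult_right integrable_abs g
        Bochner_Integration.integrable_add Bochner_Integration.integrable_diff P_int gw_int A_int)
  also have "\<dots> = 2 * (\<integral>x. P x \<partial>lebesgue) + c * N * measure lebesgue A"
    using P_int gw_int A_int A_fin gw_0
    by (simp add: Bochner_Integration.integral_add Bochner_Integration.integral_diff fmeasurableD)
  \<comment> \<open>The shell absorbs at most half of \<open>c * N\<close>; the other half, divided
    by 2, gives the constant \<open>c / 4\<close>.\<close>
  also have "\<dots> \<le> 2 * (\<integral>x. P x \<partial>lebesgue) + c * N * (1/2)"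
    using shell c(1) N_nonneg by (intro add_left_mono mult_left_mono) (auto simp: A_def)
  finally have "c * N \<le> 2 * (\<integral>x. P x \<partial>lebesgue) + c * N / 2"
    by (simp add: N_def)
  then show ?thesis
    by (simp add: set_lebesgue_integral_def P_def)
qed

theorem theorem2:
  shows "\<exists>\<epsilon>>0. \<exists>\<sigma>>0. \<forall>g :: 'a::euclidean_space \<Rightarrow> real.
      g \<in> A_minus_class \<and> radial g
      \<and> (\<forall>\<xi>. fourier g \<xi> = complex_of_real (- g \<xi>))
      \<and> g 0 = 0
      \<and> \<bar>rf g - A_minus_const TYPE('a)\<bar> \<le> \<epsilon>
      \<longrightarrow> (\<integral>x\<in>ball 0 (rf g). max (g x) 0 \<partial>lebesgue) \<ge> \<sigma> * (\<integral>x. \<bar>g x\<bar> \<partial>lebesgue)"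
proof -
  \<comment> \<open>With \<open>\<epsilon> = 1\<close>, closeness to \<open>A_minus_const\<close>
    gives \<open>rf g \<le> R\<close>, so \<open>\<delta>\<close> and \<open>c\<close> can be fixed
    before \<open>g\<close>. The absolute value ensures \<open>R \<ge> 0\<close>, as
    \<open>gaussian_gap\<close> requires.\<close>
  define R where "R = \<bar>A_minus_const TYPE('a)\<bar> + 1"
  obtain \<delta> where \<delta>: "\<delta> > 0"
    "\<And>r. 0 \<le> r \<Longrightarrow> r \<le> R \<Longrightarrow> measure lebesgue (cball (0::'a) (r + \<delta>) - ball 0 (r - \<delta>)) < 1/2"
    using thin_shell_measure[of "1/2" R] by auto
  obtain c where c: "c > 0"
    "\<And>r s. 0 \<le> r \<Longrightarrow> r \<le> R \<Longrightarrow> 0 \<le> s \<Longrightarrow> \<bar>s - r\<bar> \<ge> \<delta> \<Longrightarrow> \<bar>exp (- pi * s\<^sup>2) - exp (- pi * r\<^sup>2)\<bar> \<ge> c"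
    using gaussian_gap[OF \<delta>(1), of R] by (auto simp: R_def)
  show ?thesis
  proof (rule exI[of _ "1::real"], rule conjI, simp, rule exI[of _ "c/4"], intro conjI allI impI)
    fix g :: "'a \<Rightarrow> real"
    assume *: "g \<in> A_minus_class \<and> radial g \<and> (\<forall>\<xi>. fourier g \<xi> = complex_of_real (- g \<xi>))
      \<and> g 0 = 0 \<and> \<bar>rf g - A_minus_const TYPE('a)\<bar> \<le> 1"
    then have g: "continuous_on UNIV g" "integrable lebesgue g" "eventually_nonneg g"
      by (auto simp: A_minus_class_def)
    note r = rf_nonneg_and_sign[OF g(3)]
    have "rf g \<le> R" using * by (auto simp: R_def)
    with r(1) have shell: "measure lebesgue (cball (0::'a) (rf g + \<delta>) - ball 0 (rf g - \<delta>)) \<le> 1/2"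
      using \<delta>(2)[of "rf g"] by simp
    from \<open>rf g \<le> R\<close> * show "c / 4 * (\<integral>x. \<bar>g x\<bar> \<partial>lebesgue) \<le> (\<integral>x\<in>ball 0 (rf g). max (g x) 0 \<partial>lebesgue)"
      by (intro ball_positive_mass_ge[where \<delta> = \<delta>] g(2) borel_measurable_continuous_onI g(1) r c shell)
         auto
  qed (use c(1) in auto)
qed

end
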